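(* Let $E$ and $F$ be Banach spaces and $n\ge1$. Then $NA(\mathcal P(^nE,F))\subset R\big(B_{\mathcal P_w(^nE,F)}\big)$.
   Context: $\mathcal P(^nE,F)$ is the Banach space of continuous $n$-homogeneous polynomials $P:E\to F$ with norm $\|P\|=\sup_{\|x\|\le1}\|P(x)\|$. $\mathcal P_w(^nE,F)$ is the subspace of polynomials that are weakly continuous on bounded sets: $\|P(x_\alpha)-P(x)\|\to0$ for every bounded net $(x_\alpha)$ converging weakly to $x\in E$. $NA(\mathcal P(^nE,F))$ is the set of $P\in\mathcal P(^nE,F)$ that attain their norm on $B_E$, i.e. $\|P(x)\|=\|P\|$ for some $x\in B_E$. For a subspace $J$ of a Banach space $X$ and $x\in X$, the farthest distance is $\rho(x,B_J)=\sup\{\|x-y\|:y\in B_J\}$, and $R(B_J)=\{x\in X:\exists\,y\in B_J,\ \|x-y\|=\rho(x,B_J)\}$; here $X=\mathcal P(^nE,F)$ and $J=\mathcal P_w(^nE,F)$. *)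

theory Defs
  imports "HOL-Analysis.Analysis"
begin

text \<open>The scalar field: isometrically isomorphic to the reals or to the complex numbers.\<close>

class real_or_complex = real_normed_field +
  assumes real_or_complex:
    "\<exists>\<iota> :: 'a \<Rightarrow> complex. (\<forall>x y. \<iota> (x + y) = \<iota> x + \<iota> y) \<and>
       (\<forall>r x. \<iota> (r *\<^sub>R x) = r *\<^sub>R \<iota> x) \<and> (\<forall>x y. \<iota> (x * y) = \<iota> x * \<iota> y) \<and>
       (\<forall>x. norm (\<iota> x) = norm x) \<and> (range \<iota> = \<real> \<or> range \<iota> = UNIV)"

instance real :: real_or_complex
proof
  have "range complex_of_real = \<real>"
    by (simp add: Reals_def)
  then show "\<exists>\<iota> :: real \<Rightarrow> complex. (\<forall>x y. \<iota> (x + y) = \<iota> x + \<iota> y) \<and>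
       (\<forall>r x. \<iota> (r *\<^sub>R x) = r *\<^sub>R \<iota> x) \<and> (\<forall>x y. \<iota> (x * y) = \<iota> x * \<iota> y) \<and>
       (\<forall>x. norm (\<iota> x) = norm x) \<and> (range \<iota> = \<real> \<or> range \<iota> = UNIV)"
    by (intro exI[of _ complex_of_real]) (auto simp: scaleR_conv_of_real)
qed

instance complex :: real_or_complex
proof
  show "\<exists>\<iota> :: complex \<Rightarrow> complex. (\<forall>x y. \<iota> (x + y) = \<iota> x + \<iota> y) \<and>
       (\<forall>r x. \<iota> (r *\<^sub>R x) = r *\<^sub>R \<iota> x) \<and> (\<forall>x y. \<iota> (x * y) = \<iota> x * \<iota> y) \<and>
       (\<forall>x. norm (\<iota> x) = norm x) \<and> (range \<iota> = \<real> \<or> range \<iota> = UNIV)"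
    by (intro exI[of _ "\<lambda>z. z"]) auto
qed

text \<open>The library's normed spaces are real. A normed space over the scalar field is such a
  space together with a scalar multiplication extending the real one.\<close>

locale normed_space_over = vector_space scale
  for scale :: "'k::real_or_complex \<Rightarrow> 'a::real_normed_vector \<Rightarrow> 'a" +
  assumes scale_of_real: "scale (of_real r) x = r *\<^sub>R x"
    and norm_scale: "norm (scale c x) = norm c * norm x"

lemma normed_space_over_scaleR:
  "normed_space_over ((*\<^sub>R) :: real \<Rightarrow> 'a::real_normed_vector \<Rightarrow> 'a)"
  by unfold_locales (simp_all add: scaleR_add_right scaleR_add_left)

text \<open>The arguments of an \<open>n\<close>-linear map are the entries at \<open>0, \<dots>, n - 1\<close> of a sequence;
  the first conjunct makes all other entries irrelevant.\<close>

definition multilinear ::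
  "('k::field \<Rightarrow> 'e::ab_group_add \<Rightarrow> 'e) \<Rightarrow> ('k \<Rightarrow> 'f::ab_group_add \<Rightarrow> 'f) \<Rightarrow> nat \<Rightarrow>
    ((nat \<Rightarrow> 'e) \<Rightarrow> 'f) \<Rightarrow> bool" where
  "multilinear s t n A \<longleftrightarrow>
     (\<forall>x y. (\<forall>i<n. x i = y i) \<longrightarrow> A x = A y) \<and>
     (\<forall>x. \<forall>i<n. Vector_Spaces.linear s t (\<lambda>v. A (x(i := v))))"

definition hom_polys ::
  "('k::field \<Rightarrow> 'e::real_normed_vector \<Rightarrow> 'e) \<Rightarrow> ('k \<Rightarrow> 'f::real_normed_vector \<Rightarrow> 'f) \<Rightarrow>
    nat \<Rightarrow> ('e \<Rightarrow> 'f) set" where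
  "hom_polys s t n =
     {P. (\<exists>A. multilinear s t n A \<and> (\<forall>x. P x = A (\<lambda>_. x))) \<and> continuous_on UNIV P}"

definition poly_norm :: "('e::real_normed_vector \<Rightarrow> 'f::real_normed_vector) \<Rightarrow> real" where
  "poly_norm P = (SUP x\<in>cball 0 1. norm (P x))"

definition weak_tendsto ::
  "('k::real_normed_field \<Rightarrow> 'e::real_normed_vector \<Rightarrow> 'e) \<Rightarrow> ('i \<Rightarrow> 'e) \<Rightarrow> 'e \<Rightarrow> 'i filter \<Rightarrow> bool" where
  "weak_tendsto s u x \<F> \<longleftrightarrow>
     (\<forall>\<phi>. Vector_Spaces.linear s (*) \<phi> \<and> continuous_on UNIV \<phi> \<longrightarrow> ((\<lambda>i. \<phi> (u i)) \<longlongrightarrow> \<phi> x) \<F>)"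

text \<open>Nets are rendered as filters on the space itself: a net \<open>u\<close> along a filter \<open>\<G>\<close> on any index
  type enters only through its image filter \<open>filtermap u \<G>\<close>; see the lemma below.\<close>

definition weakly_continuous_on_bounded ::
  "('k::real_normed_field \<Rightarrow> 'e::real_normed_vector \<Rightarrow> 'e) \<Rightarrow> ('e \<Rightarrow> 'f::real_normed_vector) \<Rightarrow> bool" where
  "weakly_continuous_on_bounded s P \<longleftrightarrow>
     (\<forall>\<F> x. (\<exists>B. bounded B \<and> (\<forall>\<^sub>F y in \<F>. y \<in> B)) \<and> weak_tendsto s (\<lambda>y. y) x \<F> \<longrightarrow>
        ((\<lambda>y. norm (P y - P x)) \<longlongrightarrow> 0) \<F>)"

lemma weakly_continuous_on_bounded_net:
  assumes "weakly_continuous_on_bounded s P" "bounded (range u)" "weak_tendsto s u x \<G>"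
  shows "((\<lambda>i. norm (P (u i) - P x)) \<longlongrightarrow> 0) \<G>"
proof -
  have "weak_tendsto s (\<lambda>y. y) x (filtermap u \<G>)"
    using assms(3) by (simp add: weak_tendsto_def filterlim_filtermap)
  moreover have "\<forall>\<^sub>F y in filtermap u \<G>. y \<in> range u"
    by (simp add: eventually_filtermap)
  ultimately have "((\<lambda>y. norm (P y - P x)) \<longlongrightarrow> 0) (filtermap u \<G>)"
    using assms(1,2) unfolding weakly_continuous_on_bounded_def by blast
  then show ?thesis
    by (simp add: filterlim_filtermap)
qed

definition weak_hom_polys ::
  "('k::real_normed_field \<Rightarrow> 'e::real_normed_vector \<Rightarrow> 'e) \<Rightarrow> ('k \<Rightarrow> 'f::real_normed_vector \<Rightarrow> 'f) \<Rightarrow>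
    nat \<Rightarrow> ('e \<Rightarrow> 'f) set" where
  "weak_hom_polys s t n = {P \<in> hom_polys s t n. weakly_continuous_on_bounded s P}"

definition norm_attaining_polys ::
  "('k::field \<Rightarrow> 'e::real_normed_vector \<Rightarrow> 'e) \<Rightarrow> ('k \<Rightarrow> 'f::real_normed_vector \<Rightarrow> 'f) \<Rightarrow>
    nat \<Rightarrow> ('e \<Rightarrow> 'f) set" where
  "norm_attaining_polys s t n =
     {P \<in> hom_polys s t n. \<exists>x\<in>cball 0 1. norm (P x) = poly_norm P}"

text \<open>Below, \<open>N\<close> is the norm of the ambient space \<open>X\<close> and \<open>J\<close> is a subspace of \<open>X\<close>.\<close>

definition unit_ball_of :: "('x \<Rightarrow> real) \<Rightarrow> 'x set \<Rightarrow> 'x set" where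
  "unit_ball_of N J = {y \<in> J. N y \<le> 1}"

definition farthest_distance :: "('x::minus \<Rightarrow> real) \<Rightarrow> 'x \<Rightarrow> 'x set \<Rightarrow> real" where
  "farthest_distance N x B = (SUP y\<in>B. N (x - y))"

definition remotal_points :: "('x::minus \<Rightarrow> real) \<Rightarrow> 'x set \<Rightarrow> 'x set \<Rightarrow> 'x set" where
  "remotal_points N X B = {x \<in> X. \<exists>y\<in>B. N (x - y) = farthest_distance N x B}"

end

theory Submission imports Defs begin

text \<open>Let \<open>P\<close> attain its norm at a unit vector \<open>u\<close>, say \<open>P u = \<parallel>P\<parallel> w\<close> with \<open>w\<close> a unit vector, and let
  \<open>\<phi>\<close> be a norm-one functional with \<open>\<phi> u = 1\<close>. The polynomial \<open>Q x = - \<phi>(x)\<^sup>n w\<close> is weakly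
  continuous on bounded sets and has norm \<open>1\<close>, and at \<open>u\<close> one sees
  \<open>\<parallel>P - Q\<parallel> \<ge> \<parallel>P\<parallel> + 1\<close>, the largest possible value for \<open>Q\<close> in the unit ball.

  The functional comes from the Hahn--Banach theorem, proved via minimal sublinear functionals:
  these are automatically linear.\<close>

section \<open>The Hahn--Banach theorem\<close>

text \<open>Homogeneity is asked only as an inequality; applied to the inverse scalar it gives
  equality for \<open>r > 0\<close>, and \<open>r = 0\<close> gives
  \<open>p 0 \<le> 0\<close>.\<close>

definition sublinear :: "('a::real_vector \<Rightarrow> real) \<Rightarrow> bool" where
  "sublinear p \<longleftrightarrow> (\<forall>x y. p (x + y) \<le> p x + p y) \<and> (\<forall>r\<ge>0. \<forall>x. p (r *\<^sub>R x) \<le> r * p x)"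

lemma sublinearI:
  assumes "\<And>x y. p (x + y) \<le> p x + p y" "\<And>r x. r \<ge> 0 \<Longrightarrow> p (r *\<^sub>R x) \<le> r * p x"
  shows "sublinear p"
  using assms by (auto simp: sublinear_def)

lemma sublinear_add: "sublinear p \<Longrightarrow> p (x + y) \<le> p x + p y"
  by (simp add: sublinear_def)

lemma sublinear_scaleR_le: "sublinear p \<Longrightarrow> r \<ge> 0 \<Longrightarrow> p (r *\<^sub>R x) \<le> r * p x"
  by (simp add: sublinear_def)

lemma sublinear_zero: "sublinear p \<Longrightarrow> p 0 = 0"
  using sublinear_add[of p 0 0] sublinear_scaleR_le[of p 0 0] by simp

lemma sublinear_minus_le: "sublinear p \<Longrightarrow> - p (- x) \<le> p x"
  using sublinear_add[of p x "- x"] sublinear_zero[of p] by simp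

lemma sublinear_norm: "sublinear norm"
  by (rule sublinearI) (auto intro: norm_triangle_ineq)

text \<open>The index may change under sums and scalings, so one lemma serves both chains of
  sublinear functionals and the translates in \<open>sublinear_shift\<close>, which need not be
  sublinear one by one.\<close>

lemma sublinear_INF:
  fixes q :: "'i \<Rightarrow> 'a::real_vector \<Rightarrow> real"
  assumes ne: "I \<noteq> {}" and bdd: "\<And>x. bdd_below ((\<lambda>i. q i x) ` I)"
    and add: "\<And>i j x y. i \<in> I \<Longrightarrow> j \<in> I \<Longrightarrow> \<exists>k\<in>I. q k (x + y) \<le> q i x + q j y"
    and scale: "\<And>r i x. r > 0 \<Longrightarrow> i \<in> I \<Longrightarrow> \<exists>k\<in>I. q k (r *\<^sub>R x) \<le> r * q i x"
    and zero: "\<And>i. i \<in> I \<Longrightarrow> q i 0 = 0"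
  shows "sublinear (\<lambda>x. INF i\<in>I. q i x)"
proof (rule sublinearI)
  fix x y
  \<comment> \<open>The infima on the right are taken one after the other: over \<open>j\<close>
    with \<open>i\<close> fixed, then over \<open>i\<close>.\<close>
  have "(INF i\<in>I. q i (x + y)) - q i x \<le> q j y" if "i \<in> I" "j \<in> I" for i j
    using add[OF that, of x y] bdd unfolding diff_le_eq add.commute[of "q j y"] by (meson cINF_lower2)
  then have "(INF i\<in>I. q i (x + y)) - q i x \<le> (INF j\<in>I. q j y)" if "i \<in> I" for i
    using that by (intro cINF_greatest[OF ne])
  then have "(INF i\<in>I. q i (x + y)) - (INF j\<in>I. q j y) \<le> q i x" if "i \<in> I" for i
    using that by (metis diff_le_eq add.commute)
  then have "(INF i\<in>I. q i (x + y)) - (INF j\<in>I. q j y) \<le> (INF i\<in>I. q i x)"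
    by (intro cINF_greatest[OF ne])
  then show "(INF i\<in>I. q i (x + y)) \<le> (INF i\<in>I. q i x) + (INF i\<in>I. q i y)"
    by simp
next
  fix r :: real and x
  assume "r \<ge> 0"
  show "(INF i\<in>I. q i (r *\<^sub>R x)) \<le> r * (INF i\<in>I. q i x)"
  proof (cases "r = 0")
    case True
    with zero ne show ?thesis by simp
  next
    case False
    with \<open>r \<ge> 0\<close> have r: "r > 0" by simp
    have "(INF i\<in>I. q i (r *\<^sub>R x)) \<le> r * q i x" if "i \<in> I" for i
      using scale[OF r that, of x] bdd by (meson cINF_lower2)
    then have "(INF i\<in>I. q i (r *\<^sub>R x)) / r \<le> (INF i\<in>I. q i x)"
      using r by (intro cINF_greatest[OF ne]) (simp add: divide_le_eq mult.commute)
    then show ?thesis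
      using r by (simp add: divide_le_eq mult.commute)
  qed
qed

text \<open>Take the infimum over \<open>t \<ge> 0\<close> of
  \<open>p (x + t *\<^sub>R y) - t * p y\<close>; \<open>t = 0\<close> and \<open>t = 1\<close> give
  the two bounds. The second makes a minimal functional superadditive and, at
  \<open>x = - y\<close>, controls the value at \<open>y\<close>.\<close>

lemma sublinear_shift:
  fixes p :: "'a::real_vector \<Rightarrow> real"
  assumes p: "sublinear p"
  obtains q where "sublinear q" "\<And>x. q x \<le> p x" "\<And>x. q x \<le> p (x + y) - p y"
proof
  let ?g = "\<lambda>t x. p (x + t *\<^sub>R y) - t * p y"
  let ?q = "\<lambda>x. INF t\<in>{0..}. ?g t x"
  have le_t: "t * p y \<le> p (t *\<^sub>R y)" if "t \<ge> 0" for t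
  proof (cases "t = 0")
    case True
    then show ?thesis using sublinear_zero[OF p] by simp
  next
    case False
    then have "p y \<le> inverse t * p (t *\<^sub>R y)"
      using that sublinear_scaleR_le[OF p, of "inverse t" "t *\<^sub>R y"] by simp
    then show ?thesis
      using False that by (simp add: field_simps)
  qed
  \<comment> \<open>Since \<open>t * p y\<close> is at most \<open>p (t *\<^sub>R y)\<close>,
    subadditivity bounds the family below independently of \<open>t\<close>.\<close>
  have "- p (- x) \<le> ?g t x" if "t \<ge> 0" for t x
  proof -
    have "p (t *\<^sub>R y) \<le> p (x + t *\<^sub>R y) + p (- x)"
      using sublinear_add[OF p, of "x + t *\<^sub>R y" "- x"] by simp
    with le_t[OF that] show ?thesis by simp
  qed
  then have bdd: "bdd_below ((\<lambda>t. ?g t x) ` {0..})" for x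
    by (intro bdd_belowI2[where m = "- p (- x)"]) auto
  show "?q x \<le> p x" for x
    using cINF_lower[OF bdd, of 0 x] by simp
  show "?q x \<le> p (x + y) - p y" for x
    using cINF_lower[OF bdd, of 1 x] by simp
  show "sublinear ?q"
  proof (rule sublinear_INF[OF _ bdd])
    \<comment> \<open>Shifts add under sums and are multiplied by \<open>r\<close> under scaling,
      hence the indices \<open>s + t\<close> and \<open>r * t\<close>.\<close>
    fix s t x z
    assume "s \<in> {0::real..}" "t \<in> {0::real..}"
    then show "\<exists>k\<in>{0..}. ?g k (x + z) \<le> ?g s x + ?g t z"
      using sublinear_add[OF p, of "x + s *\<^sub>R y" "z + t *\<^sub>R y"]
      by (intro bexI[of _ "s + t"]) (auto simp: algebra_simps)
  next
    fix r t :: real and x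
    assume "r > 0" "t \<in> {0..}"
    then show "\<exists>k\<in>{0..}. ?g k (r *\<^sub>R x) \<le> r * ?g t x"
      using sublinear_scaleR_le[OF p, of r "x + t *\<^sub>R y"]
      by (intro bexI[of _ "r * t"]) (auto simp: algebra_simps)
  next
    fix t :: real
    assume "t \<in> {0..}"
    then show "?g t 0 = 0"
      using le_t[of t] sublinear_scaleR_le[OF p, of t y] by simp
  qed simp
qed

text \<open>Minimality identifies the shifted functional with \<open>p\<close>, which yields
  superadditivity. Additivity makes \<open>p\<close> odd, and the scaling inequality at
  \<open>x\<close> and \<open>- x\<close> then gives homogeneity.\<close>

lemma minimal_sublinear_linear:
  fixes p :: "'a::real_vector \<Rightarrow> real"
  assumes p: "sublinear p" and min: "\<And>q. sublinear q \<Longrightarrow> (\<And>x. q x \<le> p x) \<Longrightarrow> q = p"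
  shows "linear p"
proof -
  have "p x + p y \<le> p (x + y)" for x y
  proof -
    obtain q where q: "sublinear q" "\<And>x. q x \<le> p x" "\<And>x. q x \<le> p (x + y) - p y"
      using sublinear_shift[OF p] by blast
    then have "q = p"
      using min by blast
    with q(3)[of x] show ?thesis by simp
  qed
  then have add: "p (x + y) = p x + p y" for x y
    using sublinear_add[OF p] by (simp add: order.antisym)
  then have minus: "p (- x) = - p x" for x
    using add[of x "- x"] sublinear_zero[OF p] by simp
  have pos: "p (r *\<^sub>R x) = r * p x" if "r \<ge> 0" for r x
    using sublinear_scaleR_le[OF p that, of x] sublinear_scaleR_le[OF p that, of "- x"]
    by (simp add: minus)
  have "p (r *\<^sub>R x) = r * p x" for r x
    using pos[of r x] pos[of "- r" x] minus[of "r *\<^sub>R x"] by (cases "r \<ge> 0") auto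
  with add show ?thesis
    by (simp add: linear_iff)
qed

text \<open>Zorn's lemma for the reversed pointwise order: a nonempty chain is bounded by its
  pointwise infimum.\<close>

lemma minimal_sublinear_exists:
  fixes p :: "'a::real_vector \<Rightarrow> real"
  assumes p: "sublinear p"
  obtains m where "sublinear m" "\<And>x. m x \<le> p x"
    "\<And>q. sublinear q \<Longrightarrow> (\<And>x. q x \<le> m x) \<Longrightarrow> q = m"
proof -
  define A where "A = {q. sublinear q \<and> q \<le> p}"
  let ?R = "relation_of (\<ge>) A"
  have "\<exists>m\<in>A. \<forall>q\<in>A. m \<ge> q \<longrightarrow> q = m"
  proof (rule predicate_Zorn)
    show "partial_order_on A ?R"
      by (auto simp: partial_order_on_def preorder_on_def refl_on_def trans_def antisym_def relation_of_def)
  next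
    fix C
    assume C: "C \<in> Chains ?R"
    then have CA: "C \<subseteq> A" and tot: "\<And>f g. f \<in> C \<Longrightarrow> g \<in> C \<Longrightarrow> f \<le> g \<or> g \<le> f"
      by (auto simp: Chains_def relation_of_def)
    show "\<exists>u\<in>A. \<forall>a\<in>C. a \<ge> u"
    proof (cases "C = {}")
      case True
      with p show ?thesis by (auto simp: A_def)
    next
      case False
      \<comment> \<open>From \<open>- p (- x) \<le> - f (- x) \<le> f x\<close>: at each point a
        lower bound common to the whole chain.\<close>
      have "- p (- x) \<le> f x" if "f \<in> C" for f x
        using that CA sublinear_minus_le[of f x] by (fastforce simp: A_def le_fun_def dest: spec[of _ "- x"])
      then have bdd: "bdd_below ((\<lambda>f. f x) ` C)" for x
        by (intro bdd_belowI2[where m = "- p (- x)"])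
      have "sublinear (\<lambda>x. INF f\<in>C. f x)"
      proof (rule sublinear_INF[OF False bdd])
        fix f g x y
        assume fg: "f \<in> C" "g \<in> C"
        have "\<exists>k\<in>C. k \<le> f \<and> k \<le> g"
          using tot[OF fg] fg by auto
        then obtain k where k: "k \<in> C" "k x \<le> f x" "k y \<le> g y"
          by (auto simp: le_fun_def)
        then have "k (x + y) \<le> f x + g y"
          using CA sublinear_add[of k x y] by (fastforce simp: A_def)
        with k show "\<exists>k\<in>C. k (x + y) \<le> f x + g y" by blast
      next
        fix r :: real and f and x :: 'a
        assume "r > 0" "f \<in> C"
        then show "\<exists>k\<in>C. k (r *\<^sub>R x) \<le> r * f x"
          using CA sublinear_scaleR_le[of f r x] by (intro bexI[of _ f]) (auto simp: A_def)
      qed (use CA sublinear_zero in \<open>auto simp: A_def\<close>)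
      moreover have le: "(INF f\<in>C. f x) \<le> f x" if "f \<in> C" for f x
        using bdd that by (rule cINF_lower)
      moreover obtain f where "f \<in> C" "f \<le> p"
        using False CA by (auto simp: A_def)
      then have "(INF f\<in>C. f x) \<le> p x" for x
        using le[of f x] by (auto simp: le_fun_def intro: order_trans)
      ultimately show ?thesis
        by (intro bexI[of _ "\<lambda>x. INF f\<in>C. f x"]) (auto simp: A_def le_fun_def)
    qed
  qed
  then obtain m where m: "m \<in> A" "\<And>q. q \<in> A \<Longrightarrow> q \<le> m \<Longrightarrow> q = m"
    by blast
  show thesis
  proof (rule that[of m])
    fix q
    assume "sublinear q" "\<And>x. q x \<le> m x"
    with m show "q = m"
      by (intro m(2)) (auto simp: A_def le_fun_def intro: order_trans)
  qed (use m in \<open>auto simp: A_def le_fun_def\<close>)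
qed

text \<open>Minimality below \<open>p\<close> gives linearity but no control at \<open>u\<close>.
  The minimal functional is therefore taken below the shift of \<open>p\<close> by \<open>u\<close>,
  whose value at \<open>- u\<close> is at most \<open>- p u\<close>.\<close>

lemma hahn_banach_sublinear:
  fixes p :: "'a::real_vector \<Rightarrow> real"
  assumes p: "sublinear p"
  obtains f where "linear f" "\<And>x. f x \<le> p x" "f u = p u"
proof -
  obtain q where q: "sublinear q" "\<And>x. q x \<le> p x" "\<And>x. q x \<le> p (x + u) - p u"
    using sublinear_shift[OF p] by blast
  obtain f where f: "sublinear f" "\<And>x. f x \<le> q x"
    "\<And>g. sublinear g \<Longrightarrow> (\<And>x. g x \<le> f x) \<Longrightarrow> g = f"
    using minimal_sublinear_exists[OF q(1)] by blast
  have lin: "linear f"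
    using minimal_sublinear_linear f by blast
  have "f (- u) \<le> - p u"
    using f(2)[of "- u"] q(3)[of "- u"] sublinear_zero[OF p] by simp
  then have "f u \<ge> p u"
    using linear_neg[OF lin, of u] by simp
  moreover have "f x \<le> p x" for x
    using f(2) q(2) by (rule order_trans)
  ultimately show thesis
    using that[OF lin] by (meson order.antisym)
qed

section \<open>Scalars and norming functionals\<close>

text \<open>Replaces the abstract embedding into the complex numbers by coordinates;
  \<open>j\<close> is the preimage of the imaginary unit.\<close>

lemma real_or_complex_cases:
  obtains (real) "\<And>c::'k::real_or_complex. \<exists>r. c = of_real r"
  | (complex) j :: "'k::real_or_complex" where "j * j = - 1" "\<And>c. \<exists>a b. c = of_real a + of_real b * j"
      "\<And>a b. norm (of_real a + of_real b * j) = sqrt (a\<^sup>2 + b\<^sup>2)"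
proof -
  obtain h :: "'k \<Rightarrow> complex" where h: "\<And>x y. h (x + y) = h x + h y"
    "\<And>r x. h (r *\<^sub>R x) = r *\<^sub>R h x" "\<And>x y. h (x * y) = h x * h y"
    "\<And>x. norm (h x) = norm x" "range h = \<real> \<or> range h = UNIV"
    using real_or_complex by blast
  \<comment> \<open>The embedding is not assumed unital, but \<open>h 1\<close> is a nonzero
    idempotent of a field.\<close>
  have "h 1 * h 1 = h 1" "h 1 \<noteq> 0"
    using h(3)[of 1 1] h(4)[of 1] by auto
  then have h1: "h 1 = 1" by simp
  have hr: "h (of_real r) = of_real r" for r
    using h(2)[of r 1] by (simp add: h1 of_real_def)
  have "h (x - y) = h x - h y" for x y
    using h(1)[of "x - y" y] by simp
  then have inj: "x = y" if "h x = h y" for x y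
    using h(4)[of "x - y"] that by simp
  show thesis
    using h(5)
  proof
    assume rng: "range h = \<real>"
    have "\<exists>r. c = of_real r" for c :: 'k
    proof -
      have "h c \<in> \<real>" using rng by blast
      then obtain r where "h c = h (of_real r)"
        by (auto simp: hr elim: Reals_cases)
      with inj show ?thesis by blast
    qed
    with real show thesis by blast
  next
    assume rng: "range h = UNIV"
    then obtain j where j: "h j = \<i>" by (metis surjD)
    have hab: "h (of_real a + of_real b * j) = Complex a b" for a b
      by (simp add: h(1,3) hr j complex_eq_iff)
    have "h (- 1) = - 1"
      using hr[of "- 1"] by simp
    then have jj: "j * j = - 1"
      by (intro inj) (simp add: h(3) j)
    have "\<exists>a b. c = of_real a + of_real b * j" for c :: 'k
      by (metis hab inj complex.collapse)
    moreover have "norm (of_real a + of_real b * j) = sqrt (a\<^sup>2 + b\<^sup>2)" for a b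
      using h(4)[of "of_real a + of_real b * j"] by (simp add: hab cmod_def)
    ultimately show thesis
      using complex jj by blast
  qed
qed

lemma vector_space_mult: "vector_space ((*) :: 'k::field \<Rightarrow> 'k \<Rightarrow> 'k)"
  by unfold_locales (simp_all add: algebra_simps)

text \<open>For complex scalars this is the Bohnenblust-Sobczyk argument: the real functional
  \<open>f\<close> becomes the real part of a complex linear one.\<close>

lemma (in normed_space_over) norming_functional:
  fixes u :: 'a
  obtains \<phi> where "Vector_Spaces.linear scale (*) \<phi>" "\<And>x. norm (\<phi> x) \<le> norm x"
    "\<phi> u = of_real (norm u)"
proof -
  obtain f :: "'a \<Rightarrow> real" where f: "linear f" "\<And>x. f x \<le> norm x" "f u = norm u"
    using hahn_banach_sublinear[OF sublinear_norm] by metis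
  note f_simps = linear_add[OF f(1)] linear_scale[OF f(1)] linear_neg[OF f(1)] linear_diff[OF f(1)]
  have vs_scale: "vector_space scale" ..
  have abs_f: "\<bar>f x\<bar> \<le> norm x" for x
    using f(2)[of x] f(2)[of "- x"] by (simp add: f_simps abs_le_iff)
  show thesis
  proof (cases rule: real_or_complex_cases[where 'k = 'k])
    case real
    show thesis
    proof (rule that)
      have "of_real (f (scale c x)) = c * of_real (f x)" for c x
        using real[of c] by (auto simp: scale_of_real f_simps)
      then show "Vector_Spaces.linear scale (*) (\<lambda>x. of_real (f x))"
        by (simp add: Vector_Spaces.linear_iff vector_space_mult vs_scale f_simps)
    qed (use abs_f f(3) in auto)
  next
    case (complex j)
    \<comment> \<open>The only choice with real part \<open>f\<close> and
      \<open>\<phi> (scale j x) = j * \<phi> x\<close>.\<close>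
    define \<phi> where "\<phi> x = of_real (f x) - of_real (f (scale j x)) * j" for x
    have re_eq: "a = c" if "of_real a + of_real b * j = of_real c" for a b c
    proof -
      have "of_real (a - c) + of_real b * j = 0"
        using that by (simp add: algebra_simps)
      then show ?thesis
        using complex(3)[of "a - c" b] by simp
    qed
    have scale_j2: "scale j (scale j x) = - x" for x
      using complex(1) by simp
    have scale_ab: "scale (of_real a + of_real b * j) x = a *\<^sub>R x + b *\<^sub>R scale j x" for a b x
      by (simp add: scale_left_distrib scale_of_real flip: scale_scale)
    have scale_jR: "scale j (a *\<^sub>R x) = a *\<^sub>R scale j x" for a x
      by (simp add: mult.commute flip: scale_of_real)
    have \<phi>_scale: "\<phi> (scale c x) = c * \<phi> x" for c x
    proof -
      obtain a b where c: "c = of_real a + of_real b * j"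
        using complex(2) by blast
      have jj: "j * (j * z) = - z" for z
        using complex(1) by (simp flip: mult.assoc)
      show ?thesis
        unfolding \<phi>_def c scale_ab scale_right_distrib scale_jR scale_j2
        by (simp add: f_simps algebra_simps jj complex(1))
    qed
    have \<phi>_add: "\<phi> (x + y) = \<phi> x + \<phi> y" for x y
      by (simp add: \<phi>_def scale_right_distrib f_simps algebra_simps)
    have bound: "norm (\<phi> x) \<le> norm x" for x
    proof (cases "\<phi> x = 0")
      case False
      \<comment> \<open>Rotation by the unimodular \<open>c\<close> makes
        \<open>\<phi> (scale c x)\<close> real and nonnegative, hence equal to
        \<open>f (scale c x)\<close>.\<close>
      define c where "c = of_real (norm (\<phi> x)) / \<phi> x"
      have c: "norm c = 1" "c * \<phi> x = of_real (norm (\<phi> x))"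
        using False by (auto simp: c_def norm_divide)
      then have "of_real (f (scale c x)) + of_real (- f (scale j (scale c x))) * j =
          of_real (norm (\<phi> x))"
        using \<phi>_scale[of c x] by (simp add: \<phi>_def)
      then have "norm (\<phi> x) = f (scale c x)"
        using re_eq by metis
      also have "\<dots> \<le> norm (scale c x)"
        by (rule f)
      finally show ?thesis
        using c by (simp add: norm_scale)
    qed simp
    \<comment> \<open>The real part of \<open>\<phi> u\<close> is already \<open>norm u\<close>, so
      the bound leaves no room for an imaginary part.\<close>
    have "sqrt ((norm u)\<^sup>2 + (f (scale j u))\<^sup>2) = norm (\<phi> u)"
      using complex(3)[of "norm u" "- f (scale j u)"] by (simp add: \<phi>_def f(3))
    also have "\<dots> \<le> norm u"
      by (rule bound)
    finally have "(norm u)\<^sup>2 + (f (scale j u))\<^sup>2 \<le> (norm u)\<^sup>2"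
      using real_sqrt_le_iff real_sqrt_abs2 by (metis norm_ge_zero real_sqrt_unique real_le_lsqrt sqrt_le_D)
    then have "f (scale j u) = 0"
      by simp
    then have "\<phi> u = of_real (norm u)"
      by (simp add: \<phi>_def f(3))
    with bound show thesis
      by (intro that[of \<phi>]) (simp_all add: Vector_Spaces.linear_iff vector_space_mult vs_scale \<phi>_add \<phi>_scale)
  qed
qed

section \<open>Homogeneous polynomials\<close>

text \<open>Scalars are extracted one argument at a time, so the induction runs over sequences whose
  first \<open>k\<close> entries are scaled.\<close>

lemma multilinear_diagonal_scale:
  assumes t: "vector_space t" and A: "multilinear s t n A" and "k \<le> n"
  shows "A (\<lambda>i. if i < k then s c x else x) = t (c ^ k) (A (\<lambda>_. x))"
  using \<open>k \<le> n\<close>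
proof (induction k)
  case 0
  then show ?case
    using t by (simp add: vector_space_def)
next
  case (Suc k)
  let ?y = "\<lambda>i. if i < k then s c x else x"
  have lin: "Vector_Spaces.linear s t (\<lambda>v. A (?y(k := v)))"
    using A Suc.prems by (auto simp: multilinear_def)
  have "(\<lambda>i. if i < Suc k then s c x else x) = ?y(k := s c x)" "?y(k := x) = ?y"
    by auto
  then have "A (\<lambda>i. if i < Suc k then s c x else x) = t c (A ?y)"
    using lin by (simp add: Vector_Spaces.linear_iff)
  also have "\<dots> = t (c ^ Suc k) (A (\<lambda>_. x))"
    using Suc lin by (simp add: Vector_Spaces.linear_iff vector_space_def)
  finally show ?case .
qed

lemma hom_polys_scale:
  assumes t: "vector_space t" and "P \<in> hom_polys s t n"
  shows "P (s c x) = t (c ^ n) (P x)"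
proof -
  obtain A where A: "multilinear s t n A" "\<And>x. P x = A (\<lambda>_. x)"
    using assms by (auto simp: hom_polys_def)
  have "A (\<lambda>_. s c x) = A (\<lambda>i. if i < n then s c x else x)"
    using A(1) by (simp add: multilinear_def)
  with multilinear_diagonal_scale[OF t A(1) order_refl] A(2) show ?thesis
    by simp
qed

lemma hom_polys_scaleR:
  assumes "normed_space_over s" "normed_space_over t" "P \<in> hom_polys s t n"
  shows "P (r *\<^sub>R x) = r ^ n *\<^sub>R P x"
  using hom_polys_scale[OF _ assms(3), of "of_real r" x] assms(2)
  by (simp add: normed_space_over_def[of t] normed_space_over.scale_of_real[OF assms(1)]
      normed_space_over.scale_of_real[OF assms(2)] flip: of_real_power)

text \<open>Continuity at \<open>0\<close>, where \<open>P\<close> vanishes because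
  \<open>n \<ge> 1\<close>, bounds \<open>P\<close> on a small ball, and homogeneity carries the
  bound to the unit ball. It makes the supremum in \<open>poly_norm\<close> meaningful.\<close>

lemma hom_polys_bdd_above:
  assumes s: "normed_space_over s" and t: "normed_space_over t"
    and P: "P \<in> hom_polys s t n" and n: "n \<ge> 1"
  shows "bdd_above ((\<lambda>x. norm (P x)) ` cball 0 1)"
proof -
  note hom = hom_polys_scaleR[OF s t P]
  have "P 0 = 0"
    using hom[of 0 0] n by (simp add: power_0_left)
  moreover have "isCont P 0"
    using P by (simp add: hom_polys_def continuous_on_eq_continuous_at)
  ultimately obtain d where d: "d > 0" "\<And>x. norm x < d \<Longrightarrow> norm (P x) < 1"
    unfolding continuous_at_eps_delta by (metis dist_0_norm dist_commute zero_less_one)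
  show ?thesis
  proof (rule bdd_aboveI2)
    fix x :: 'b
    assume x: "x \<in> cball 0 1"
    \<comment> \<open>The factor is \<open>d / 2\<close> because the estimate needs norm strictly
      below \<open>d\<close>, while \<open>x\<close> may have norm \<open>1\<close>.\<close>
    have "norm ((d / 2) *\<^sub>R x) \<le> d / 2"
      using x d(1) by (simp add: mult_left_le)
    then have "norm (P ((d / 2) *\<^sub>R x)) < 1"
      using d by simp
    then have "(d / 2) ^ n * norm (P x) < 1"
      using d(1) by (simp add: hom power_abs)
    then show "norm (P x) \<le> 1 / (d / 2) ^ n"
      using d(1) by (simp add: field_simps)
  qed
qed

lemma norm_le_poly_norm:
  assumes "bdd_above ((\<lambda>x. norm (P x)) ` cball 0 1)" "norm x \<le> 1"
  shows "norm (P x) \<le> poly_norm P"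
  unfolding poly_norm_def using assms by (intro cSUP_upper) auto

lemma poly_norm_le:
  assumes "\<And>x. norm x \<le> 1 \<Longrightarrow> norm (P x) \<le> c"
  shows "poly_norm P \<le> c"
  unfolding poly_norm_def using assms by (intro cSUP_least) auto

text \<open>The polynomial sees \<open>x\<close> only through \<open>\<phi> x\<close>, and weak
  convergence means convergence of such values. The underlying multilinear map is the product of the
  \<open>\<phi> (x i)\<close> times \<open>v\<close>.\<close>

lemma functional_power_in_weak_hom_polys:
  assumes s: "normed_space_over s" and t: "normed_space_over t"
    and \<phi>: "Vector_Spaces.linear s (*) \<phi>" and cont: "continuous_on UNIV \<phi>"
  shows "(\<lambda>x. t (\<phi> x ^ n) v) \<in> weak_hom_polys s t n"
proof -
  interpret t: normed_space_over t by fact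
  have vs: "vector_space s" "vector_space t"
    using s t by (auto simp: normed_space_over_def)
  have norm_diff: "norm (t a v - t b v) = norm (a - b) * norm v" for a b
    by (simp add: t.norm_scale flip: t.scale_left_diff_distrib)
  \<comment> \<open>Scaling \<open>v\<close> is Lipschitz in the scalar with constant
    \<open>norm v\<close>; this serves both norm and weak continuity.\<close>
  have lim: "((\<lambda>x. t (g x) v) \<longlongrightarrow> t b v) F" if "(g \<longlongrightarrow> b) F" for g b and F :: "'b filter"
  proof -
    have "((\<lambda>x. norm (g x - b) * norm v) \<longlongrightarrow> 0) F"
      using that by (auto intro!: tendsto_mult_left_zero simp: tendsto_norm_zero_iff LIM_zero)
    then show ?thesis
      by (simp add: norm_diff tendsto_norm_zero_iff LIM_zero_iff flip: norm_diff)
  qed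
  let ?A = "\<lambda>x. t (\<Prod>i<n. \<phi> (x i)) v"
  have "multilinear s t n ?A"
    unfolding multilinear_def
  proof (intro conjI allI impI)
    fix x y :: "nat \<Rightarrow> 'b"
    assume "\<forall>i<n. x i = y i"
    then show "?A x = ?A y" by simp
  next
    fix x :: "nat \<Rightarrow> 'b" and i
    assume i: "i < n"
    have "(\<Prod>k<n. \<phi> ((x(i := w)) k)) = \<phi> w * (\<Prod>k\<in>{..<n} - {i}. \<phi> (x k))" for w
      using i by (subst prod.remove[of _ i]) (auto intro!: prod.cong)
    then show "Vector_Spaces.linear s t (\<lambda>w. ?A (x(i := w)))"
      using \<phi> by (simp add: Vector_Spaces.linear_iff vs t.scale_left_distrib distrib_right mult.assoc)
  qed
  moreover have "continuous_on UNIV (\<lambda>x. t (\<phi> x ^ n) v)"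
    using cont unfolding continuous_on_def by (auto intro!: lim tendsto_power)
  ultimately have "(\<lambda>x. t (\<phi> x ^ n) v) \<in> hom_polys s t n"
    by (auto simp: hom_polys_def intro!: exI[of _ ?A])
  moreover have "weakly_continuous_on_bounded s (\<lambda>x. t (\<phi> x ^ n) v)"
    unfolding weakly_continuous_on_bounded_def
  proof (intro allI impI)
    fix F x
    assume "(\<exists>B. bounded B \<and> (\<forall>\<^sub>F y in F. y \<in> B)) \<and> weak_tendsto s (\<lambda>y. y) x F"
    then have "(\<phi> \<longlongrightarrow> \<phi> x) F"
      using \<phi> cont by (auto simp: weak_tendsto_def)
    then have "((\<lambda>y. t (\<phi> y ^ n) v) \<longlongrightarrow> t (\<phi> x ^ n) v) F"
      by (intro lim tendsto_power)
    then show "((\<lambda>y. norm (t (\<phi> y ^ n) v - t (\<phi> x ^ n) v)) \<longlongrightarrow> 0) F"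
      by (simp add: tendsto_norm_zero_iff LIM_zero)
  qed
  ultimately show ?thesis
    by (simp add: weak_hom_polys_def)
qed

section \<open>Farthest points of the unit ball\<close>

text \<open>The triangle inequality bounds every distance to the ball by
  \<open>poly_norm P + 1\<close>, and \<open>Q\<close> reaches it. Taking \<open>w\<close> as given
  instead of normalising \<open>P u\<close> lets the zero polynomial be covered too.\<close>

lemma attains_at_unit_vector_remotal:
  fixes s :: "'k::real_or_complex \<Rightarrow> 'e::real_normed_vector \<Rightarrow> 'e"
    and t :: "'k \<Rightarrow> 'f::real_normed_vector \<Rightarrow> 'f"
  assumes s: "normed_space_over s" and t: "normed_space_over t" and n: "n \<ge> 1"
    and P: "P \<in> hom_polys s t n"
    and u: "norm u = 1" and w: "norm w = 1" and Pu: "P u = poly_norm P *\<^sub>R w"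
  shows "P \<in> remotal_points poly_norm (hom_polys s t n) (unit_ball_of poly_norm (weak_hom_polys s t n))"
proof -
  let ?B = "unit_ball_of poly_norm (weak_hom_polys s t n)"
  interpret s: normed_space_over s by fact
  interpret t: normed_space_over t by fact
  obtain \<phi> where \<phi>: "Vector_Spaces.linear s (*) \<phi>" "\<And>x. norm (\<phi> x) \<le> norm x"
    "\<phi> u = of_real (norm u)"
    using s.norming_functional by blast
  have "\<phi> (x - y) = \<phi> x - \<phi> y" for x y
    using \<phi>(1) unfolding Vector_Spaces.linear_iff by (metis diff_add_cancel eq_diff_eq)
  then have "dist (\<phi> x) (\<phi> y) \<le> dist x y" for x y
    using \<phi>(2)[of "x - y"] by (simp add: dist_norm)
  then have cont: "continuous_on UNIV \<phi>"
    unfolding continuous_on_iff by (meson order.strict_trans1)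
  \<comment> \<open>The minus sign aligns the values: as \<open>\<phi> u = 1\<close>,
    \<open>P - Q\<close> at \<open>u\<close> is \<open>P u + w\<close>.\<close>
  define Q where "Q = (\<lambda>x. t (\<phi> x ^ n) (- w))"
  have Q: "Q \<in> weak_hom_polys s t n"
    unfolding Q_def by (rule functional_power_in_weak_hom_polys[OF s t \<phi>(1) cont])
  have "norm (Q x) \<le> 1" if "norm x \<le> 1" for x
    using \<phi>(2)[of x] that w by (simp add: Q_def t.norm_scale norm_power power_le_one)
  then have QB: "Q \<in> ?B"
    using Q by (simp add: unit_ball_of_def poly_norm_le)
  have bddP: "bdd_above ((\<lambda>x. norm (P x)) ` cball 0 1)"
    by (rule hom_polys_bdd_above[OF s t P n])
  have le: "norm ((P - y) x) \<le> poly_norm P + 1" if y: "y \<in> ?B" and x: "norm x \<le> 1" for y x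
  proof -
    have "bdd_above ((\<lambda>x. norm (y x)) ` cball 0 1)"
      using y by (intro hom_polys_bdd_above[OF s t _ n]) (auto simp: unit_ball_of_def weak_hom_polys_def)
    then have "norm (y x) \<le> 1"
      using norm_le_poly_norm[of y x] x y by (auto simp: unit_ball_of_def)
    then show ?thesis
      using norm_le_poly_norm[OF bddP x] norm_triangle_ineq4[of "P x" "y x"] by simp
  qed
  then have le': "poly_norm (P - y) \<le> poly_norm P + 1" if "y \<in> ?B" for y
    using that by (intro poly_norm_le)
  have "0 \<le> poly_norm P"
    using norm_le_poly_norm[OF bddP, of u] u norm_ge_zero[of "P u"] by linarith
  moreover have "(P - Q) u = (poly_norm P + 1) *\<^sub>R w"
    by (simp add: Pu Q_def \<phi>(3) u scaleR_add_left)
  ultimately have "poly_norm P + 1 = norm ((P - Q) u)"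
    by (simp add: w)
  also have "\<dots> \<le> poly_norm (P - Q)"
    using le[OF QB] u by (intro norm_le_poly_norm bdd_aboveI2[where M = "poly_norm P + 1"]) auto
  finally have "poly_norm (P - Q) = (SUP y\<in>?B. poly_norm (P - y))"
    using QB le' by (intro cSup_eq_maximum[symmetric]) (auto intro: order_trans)
  with P QB show ?thesis
    by (auto simp: remotal_points_def farthest_distance_def)
qed

theorem proposition1p11:
  fixes scaleE :: "'k::real_or_complex \<Rightarrow> 'e::banach \<Rightarrow> 'e"
    and scaleF :: "'k \<Rightarrow> 'f::banach \<Rightarrow> 'f"
    and n :: nat
  assumes "normed_space_over scaleE"
    and "normed_space_over scaleF"
    and "n \<ge> 1"
  shows "norm_attaining_polys scaleE scaleF n \<subseteq>
    remotal_points poly_norm (hom_polys scaleE scaleF n)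
      (unit_ball_of poly_norm (weak_hom_polys scaleE scaleF n))"
proof
  fix P
  assume "P \<in> norm_attaining_polys scaleE scaleF n"
  then obtain x0 where P: "P \<in> hom_polys scaleE scaleF n" and x0: "norm x0 \<le> 1"
    and max: "norm (P x0) = poly_norm P"
    by (auto simp: norm_attaining_polys_def)
  note hom = hom_polys_scaleR[OF assms(1,2)]
  have bdd: "bdd_above ((\<lambda>x. norm (P x)) ` cball 0 1)"
    by (rule hom_polys_bdd_above[OF assms(1,2) P assms(3)])
  note remotal = attains_at_unit_vector_remotal[OF assms P]
  let ?B = "unit_ball_of poly_norm (weak_hom_polys scaleE scaleF n)"
  have "poly_norm P \<ge> 0"
    using max by (metis norm_ge_zero)
  \<comment> \<open>The construction needs unit vectors in both spaces, and the direction of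
    \<open>P u\<close> only when \<open>P\<close> is nonzero; hence three cases.\<close>
  then consider "poly_norm P > 0"
    | x :: 'e and w :: 'f where "poly_norm P = 0" "x \<noteq> 0" "w \<noteq> 0"
    | "(\<forall>x::'e. x = 0) \<or> (\<forall>w::'f. w = 0)"
    by (cases "poly_norm P = 0") (blast, simp)
  then show "P \<in> remotal_points poly_norm (hom_polys scaleE scaleF n) ?B"
  proof cases
    case 1
    have P0: "P 0 = 0"
      using hom[OF P, of 0 0] assms(3) by (simp add: power_0_left)
    then have "x0 \<noteq> 0"
      using 1 max by auto
    \<comment> \<open>As \<open>norm x0 \<le> 1\<close>, homogeneity shows that normalising
      \<open>x0\<close> cannot decrease the norm of the value, so the norm is attained on the unit
      sphere.\<close>
    define u where "u = x0 /\<^sub>R norm x0"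
    have u: "norm u = 1" "P x0 = norm x0 ^ n *\<^sub>R P u"
      using \<open>x0 \<noteq> 0\<close> by (simp_all add: u_def flip: hom[OF P])
    have "poly_norm P = norm x0 ^ n * norm (P u)"
      using max u(2) by simp
    also have "\<dots> \<le> norm (P u)"
      using x0 by (simp add: mult_right_le_one_le mult_left_le_one_le power_le_one)
    finally have Pu: "norm (P u) = poly_norm P"
      using norm_le_poly_norm[OF bdd, of u] u(1) by simp
    show ?thesis
      by (rule remotal[OF u(1), of "P u /\<^sub>R poly_norm P"]) (use 1 Pu in auto)
  next
    case 2
    have "P (x /\<^sub>R norm x) = 0"
      using norm_le_poly_norm[OF bdd, of "x /\<^sub>R norm x"] 2 by simp
    then show ?thesis
      by (intro remotal[of "x /\<^sub>R norm x" "w /\<^sub>R norm w"]) (use 2 in auto)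
  next
    case 3
    \<comment> \<open>If one space is trivial, only the zero polynomial exists; over a trivial
      domain this relies on \<open>n \<ge> 1\<close>.\<close>
    have zero: "R = (\<lambda>_. 0)" if "R \<in> hom_polys scaleE scaleF n" for R
    proof
      fix x
      have "R 0 = 0"
        using hom[OF that, of 0 0] assms(3) by (simp add: power_0_left)
      moreover have "x = 0 \<or> R x = 0"
        using 3 by blast
      ultimately show "R x = 0"
        by auto
    qed
    have lin0: "Vector_Spaces.linear scaleE (*) (\<lambda>_. 0)"
      using assms(1) by (simp add: Vector_Spaces.linear_iff normed_space_over_def vector_space_mult)
    \<comment> \<open>The zero functional and \<open>v = 0\<close> give a member of the ball, which
      is then a singleton, so the supremum is trivially attained.\<close>
    have Q: "(\<lambda>_. scaleF (0 ^ n) 0) \<in> weak_hom_polys scaleE scaleF n"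
      using functional_power_in_weak_hom_polys[OF assms(1,2) lin0] by simp
    moreover have "(\<lambda>_::'e. scaleF (0 ^ n) 0) = (\<lambda>_. 0)"
      using Q by (intro zero) (simp add: weak_hom_polys_def)
    ultimately have "(\<lambda>_. 0) \<in> ?B"
      by (simp add: unit_ball_of_def poly_norm_def)
    moreover from this have "?B = {\<lambda>_. 0}"
      using zero by (auto simp: unit_ball_of_def weak_hom_polys_def)
    ultimately show ?thesis
      using P by (auto simp: remotal_points_def farthest_distance_def)
  qed
qed

end
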